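(* Let $n\ge2$ be fixed. There is a constant $C$ depending only on $n$ such that for every $r\ge1$ and every family of permutations $w_1,\dots,w_n\in \mathrm{Sym}(r)$, the number of inversions of the family is at most $$\frac{2r^n}{n\cdot n!}+C\,r^{n-1}.$$
   Context: $\mathrm{Sym}(r)$ is the group of bijections of $[r]=\{1,\dots,r\}$. For $w\in \mathrm{Sym}(r)$ and $1\le i_1,\dots,i_n\le r$ put $m_w(i_1,\dots,i_n)=w^{-1}(\min\{w(i_1),\dots,w(i_n)\})$. A set $\{i_1,\dots,i_n\}\subseteq[r]$ is an inversion of the family $w_1,\dots,w_n\in \mathrm{Sym}(r)$ if the integers $m_{w_1}(i_1,\dots,i_n),\dots,m_{w_n}(i_1,\dots,i_n)$ are pairwise distinct (in which case they are exactly $i_1,\dots,i_n$, so the set has $n$ elements). Inversions are counted as (unordered) sets. *)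

theory Defs
  imports Complex_Main "HOL-Combinatorics.Permutations"
begin

text \<open>
  Elements of Sym(r) are functions on the naturals that permute \<open>{1..r}\<close> (and fix
  every number outside it, so that \<open>inv w\<close> is the inverse permutation).
  A tuple of indices is a function \<open>i\<close>, only the values \<open>i 1, \<dots>, i n\<close> being relevant;
  likewise \<open>w 1, \<dots>, w n\<close> for a family of permutations.
\<close>

definition m_perm :: "nat \<Rightarrow> (nat \<Rightarrow> nat) \<Rightarrow> (nat \<Rightarrow> nat) \<Rightarrow> nat" where
  "m_perm n w i = inv w (Min {w (i k) | k. k \<in> {1..n}})"

definition is_inversion :: "nat \<Rightarrow> nat \<Rightarrow> (nat \<Rightarrow> nat \<Rightarrow> nat) \<Rightarrow> nat set \<Rightarrow> bool" where
  "is_inversion n r w I \<longleftrightarrow>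
     (\<exists>i. (\<forall>k\<in>{1..n}. i k \<in> {1..r}) \<and> I = i ` {1..n} \<and>
          inj_on (\<lambda>k. m_perm n (w k) i) {1..n})"

definition inversions :: "nat \<Rightarrow> nat \<Rightarrow> (nat \<Rightarrow> nat \<Rightarrow> nat) \<Rightarrow> nat set set" where
  "inversions n r w = {I. is_inversion n r w I}"

end

theory Submission
  imports Defs
begin

text \<open>
  Say that a family of rankings separates a set \<open>S\<close> if its members attain their minima on \<open>S\<close> at
  pairwise distinct points; inversions are exactly the \<open>n\<close>-element sets separated by
  \<open>w\<^sub>1, \<dots>, w\<^sub>n\<close>. Let \<open>T\<close> have only \<open>n - 1\<close> elements. Two of the \<open>n\<close> members then share their
  minimum on \<open>T\<close>, so the family without \<open>w\<^sub>k\<close> can separate \<open>T\<close> for at most two values of \<open>k\<close>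
  (\<open>card_inj_on_remove_le_2\<close>). Averaging over \<open>k\<close>, every ground set \<open>U\<close> admits a \<open>k\<close> such that
  at most \<open>2/n\<close> times \<open>\<bar>U\<bar> choose (n - 1)\<close> of the \<open>(n - 1)\<close>-subsets of \<open>U\<close> are separated by
  the family without \<open>w\<^sub>k\<close> (\<open>exists_index_few_separated\<close>).

  For this \<open>k\<close>, let \<open>x\<close> be the point of \<open>U\<close> at which \<open>w\<^sub>k\<close> is minimal. In an inversion \<open>S \<subseteq> U\<close>
  containing \<open>x\<close>, the point \<open>x\<close> is the minimum for \<open>w\<^sub>k\<close>, hence for no other member, so that
  \<open>S - {x}\<close> is separated by the family without \<open>w\<^sub>k\<close>. The choice of \<open>k\<close> therefore bounds the
  number of inversions through \<open>x\<close>. Deleting \<open>x\<close> from \<open>U\<close> and iterating, with a new \<open>k\<close> at each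
  step, the number of inversions is at most
  \<open>2/n\<close> times \<open>(r + 1) choose n = (r choose n) + (r choose (n - 1))\<close>, and \<open>C = 1\<close> suffices.
\<close>

text \<open>
  The rankings \<open>f k\<close>, for \<open>k \<in> K\<close>, attain their minima on \<open>S\<close> at pairwise distinct points.
  This is meaningful only for finite nonempty \<open>S\<close> on which every \<open>f k\<close> is injective.
\<close>

definition separates :: "('k \<Rightarrow> 'a \<Rightarrow> 'b::linorder) \<Rightarrow> 'k set \<Rightarrow> 'a set \<Rightarrow> bool" where
  "separates f K S \<longleftrightarrow> inj_on (\<lambda>k. arg_min_on (f k) S) K"

lemma arg_min_on_in:
  fixes f :: "'a \<Rightarrow> 'b::linorder"
  assumes "finite S" "S \<noteq> {}"
  shows "arg_min_on f S \<in> S"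
  using arg_min_if_finite(1)[OF assms] .

lemma arg_min_on_eqI:
  fixes f :: "'a \<Rightarrow> 'b::linorder"
  assumes "finite S" "inj_on f S" "x \<in> S" "\<And>y. y \<in> S \<Longrightarrow> f x \<le> f y"
  shows "arg_min_on f S = x"
proof -
  have S: "S \<noteq> {}" using assms by auto
  have a: "arg_min_on f S \<in> S" by (rule arg_min_on_in[OF assms(1) S])
  have "f (arg_min_on f S) \<le> f x"
    by (rule arg_min_least[OF assms(1) S assms(3)])
  with assms(4)[OF a] have "f (arg_min_on f S) = f x" by simp
  with a assms show ?thesis by (auto dest: inj_onD)
qed

lemma arg_min_on_subset_eq:
  fixes f :: "'a \<Rightarrow> 'b::linorder"
  assumes "finite U" "inj_on f U" "S \<subseteq> U" "arg_min_on f U \<in> S"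
  shows "arg_min_on f S = arg_min_on f U"
proof (rule arg_min_on_eqI)
  show "finite S" using assms finite_subset by blast
  show "inj_on f S" using assms inj_on_subset by blast
  fix y assume "y \<in> S"
  then have "y \<in> U" using assms by auto
  then show "f (arg_min_on f U) \<le> f y" using arg_min_least[OF assms(1)] by auto
qed (fact assms)

text \<open>
  If \<open>g i = g j\<close> with \<open>i \<noteq> j\<close>, only the removal of \<open>i\<close> or of \<open>j\<close> can restore injectivity.
\<close>

lemma card_inj_on_remove_le_2:
  assumes "\<not> inj_on g K"
  shows "card {k\<in>K. inj_on g (K - {k})} \<le> 2"
proof -
  obtain i j where ij: "i \<in> K" "j \<in> K" "i \<noteq> j" "g i = g j"
    using assms by (auto simp: inj_on_def)
  have "{k\<in>K. inj_on g (K - {k})} \<subseteq> {i, j}"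
    using ij by (auto simp: inj_on_def)
  then have "card {k\<in>K. inj_on g (K - {k})} \<le> card {i, j}"
    by (intro card_mono) auto
  also have "\<dots> \<le> 2" by (simp add: card_insert_if)
  finally show ?thesis .
qed

lemma exists_index_few_separated:
  fixes f :: "'k \<Rightarrow> 'a \<Rightarrow> 'b::linorder"
  assumes K: "finite K" "card K \<ge> 2" and U: "finite U"
  shows "\<exists>k\<in>K. card K * card {T. T \<subseteq> U \<and> card T = card K - 1 \<and> separates f (K - {k}) T}
           \<le> 2 * (card U choose (card K - 1))"
proof (rule ccontr)
  define A where "A = {T. T \<subseteq> U \<and> card T = card K - 1}"
  define E where "E k = {T\<in>A. separates f (K - {k}) T}" for k
  have E: "E k = {T. T \<subseteq> U \<and> card T = card K - 1 \<and> separates f (K - {k}) T}" for k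
    by (auto simp: E_def A_def)
  have finA: "finite A" using U by (simp add: A_def)
  have cardA: "card A = card U choose (card K - 1)"
    unfolding A_def by (rule n_subsets[OF U])
  have le2: "card {k\<in>K. separates f (K - {k}) T} \<le> 2" if T: "T \<in> A" for T
  proof -
    have T': "finite T" "T \<noteq> {}" "card T < card K"
      using T K U by (auto simp: A_def intro: finite_subset)
    let ?g = "\<lambda>k. arg_min_on (f k) T"
    have "?g ` K \<subseteq> T" using T' by (auto intro: arg_min_on_in)
    then have "\<not> inj_on ?g K" using T' card_inj_on_le[of ?g K T] by auto
    then show ?thesis unfolding separates_def by (rule card_inj_on_remove_le_2)
  qed
  \<comment> \<open>double counting of the pairs \<open>(k, T)\<close> such that \<open>f\<close> without index \<open>k\<close> separates \<open>T\<close>\<close>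
  have "(\<Sum>k\<in>K. card (E k)) = (\<Sum>T\<in>A. card {k\<in>K. separates f (K - {k}) T})"
    unfolding E_def using K(1) finA by (intro sum_multicount_gen) auto
  also have "\<dots> \<le> (\<Sum>T\<in>A. 2)" by (intro sum_mono le2)
  finally have total: "(\<Sum>k\<in>K. card (E k)) \<le> 2 * card A" by simp
  assume "\<not> ?thesis"
  then have "2 * card A < card K * card (E k)" if "k \<in> K" for k
    using that by (auto simp: E cardA not_le)
  then have "(\<Sum>k\<in>K. 2 * card A) < (\<Sum>k\<in>K. card K * card (E k))"
    using K by (intro sum_strict_mono) auto
  then have "card K * (2 * card A) < card K * (\<Sum>k\<in>K. card (E k))"
    by (simp add: sum_distrib_left)
  with total show False by simp
qed

lemma separates_remove_min:
  fixes f :: "'k \<Rightarrow> 'a \<Rightarrow> 'b::linorder"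
  assumes S: "finite S" and k: "k \<in> K" and inj: "\<And>l. l \<in> K \<Longrightarrow> inj_on (f l) S"
    and sep: "separates f K S" and x: "x \<in> S" "arg_min_on (f k) S = x"
  shows "separates f (K - {k}) (S - {x})"
proof -
  have "arg_min_on (f l) (S - {x}) = arg_min_on (f l) S" if l: "l \<in> K - {k}" for l
  proof (rule arg_min_on_subset_eq)
    have "arg_min_on (f l) S \<noteq> x"
      using sep l k x by (auto simp: separates_def inj_on_def)
    then show "arg_min_on (f l) S \<in> S - {x}"
      using arg_min_on_in[OF S] x by auto
  qed (use S inj l in auto)
  then have "separates f (K - {k}) (S - {x}) \<longleftrightarrow> separates f (K - {k}) S"
    unfolding separates_def by (rule inj_on_cong)
  also have "\<dots>" using sep unfolding separates_def by (rule inj_on_subset) auto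
  finally show ?thesis .
qed

text \<open>
  The point deleted from \<open>U\<close> depends on the index chosen for \<open>U\<close>, which is why the sets through it
  are bounded by a count over all of \<open>U\<close> rather than over the remaining points. Summing these counts
  over the successive ground sets gives \<open>Suc (card U)\<close> in the binomial coefficient.
\<close>

lemma card_separated_le:
  fixes f :: "'k \<Rightarrow> 'a \<Rightarrow> 'b::linorder"
  assumes K: "finite K" "card K \<ge> 2" and "finite U"
    and "\<And>k. k \<in> K \<Longrightarrow> inj_on (f k) U"
  shows "card K * card {S. S \<subseteq> U \<and> card S = card K \<and> separates f K S}
           \<le> 2 * (Suc (card U) choose card K)"
  using assms(3,4)
proof (induction "card U" arbitrary: U)
  case 0
  then have "{S. S \<subseteq> U \<and> card S = card K \<and> separates f K S} = {}" using K by auto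
  then show ?case by (simp only: card.empty)
next
  case (Suc m)
  define N where "N V = {S. S \<subseteq> V \<and> card S = card K \<and> separates f K S}" for V
  obtain k where k: "k \<in> K" and few:
    "card K * card {T. T \<subseteq> U \<and> card T = card K - 1 \<and> separates f (K - {k}) T}
       \<le> 2 * (card U choose (card K - 1))" (is "card K * card ?E \<le> _")
    using exists_index_few_separated[OF K Suc.prems(1), of f] by blast
  define x where "x = arg_min_on (f k) U"
  have "U \<noteq> {}" using Suc.hyps(2) by auto
  then have xU: "x \<in> U" unfolding x_def by (rule arg_min_on_in[OF Suc.prems(1)])
  have finE: "finite ?E" using Suc.prems(1) by simp
  \<comment> \<open>separated sets avoiding \<open>x\<close>, and those through \<open>x\<close>, which arise by adding \<open>x\<close> to a member
     of the small family\<close>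
  have sub: "N U \<subseteq> N (U - {x}) \<union> insert x ` ?E"
  proof
    fix S assume S: "S \<in> N U"
    show "S \<in> N (U - {x}) \<union> insert x ` ?E"
    proof (cases "x \<in> S")
      case False
      then show ?thesis using S by (auto simp: N_def)
    next
      case True
      have S': "S \<subseteq> U" "card S = card K" "separates f K S" using S by (auto simp: N_def)
      have finS: "finite S" using S' Suc.prems(1) finite_subset by blast
      have "arg_min_on (f k) S = x"
        unfolding x_def using True S' Suc.prems k
        by (intro arg_min_on_subset_eq) (auto simp: x_def)
      then have "separates f (K - {k}) (S - {x})"
        using inj_on_subset[OF Suc.prems(2) S'(1)] S'(3) True
        by (intro separates_remove_min finS k)
      then have "S - {x} \<in> ?E" using S' True finS by auto
      moreover have "S = insert x (S - {x})" using True by auto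
      ultimately show ?thesis by blast
    qed
  qed
  have "card (N U) \<le> card (N (U - {x}) \<union> insert x ` ?E)"
    using Suc.prems(1) finE by (intro card_mono sub) (auto simp: N_def)
  also have "\<dots> \<le> card (N (U - {x})) + card (insert x ` ?E)" by (rule card_Un_le)
  also have "\<dots> \<le> card (N (U - {x})) + card ?E" using card_image_le[OF finE] by simp
  finally have step: "card (N U) \<le> card (N (U - {x})) + card ?E" .
  have "card K * card (N (U - {x})) \<le> 2 * (Suc (card (U - {x})) choose card K)"
    unfolding N_def
  proof (rule Suc.hyps(1))
    show "m = card (U - {x})" using Suc.hyps(2) Suc.prems(1) xU by simp
    show "inj_on (f k) (U - {x})" if "k \<in> K" for k
      using Suc.prems(2)[OF that] by (rule inj_on_subset) auto
  qed (use Suc.prems(1) in simp)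
  also have "Suc (card (U - {x})) = card U" using xU Suc.hyps(2) Suc.prems(1) by simp
  finally have IH: "card K * card (N (U - {x})) \<le> 2 * (card U choose card K)" .
  have "card K * card (N U) \<le> card K * card (N (U - {x})) + card K * card ?E"
    using mult_le_mono2[OF step, of "card K"] by (simp add: distrib_left)
  also have "\<dots> \<le> 2 * (card U choose card K) + 2 * (card U choose (card K - 1))"
    using IH few by (rule add_mono)
  also have "\<dots> = 2 * (Suc (card U) choose card K)"
    using K by (cases "card K") auto
  finally show ?case unfolding N_def .
qed

lemma m_perm_eq_arg_min_on:
  assumes "w permutes A" "n \<ge> 1"
  shows "m_perm n w i = arg_min_on w (i ` {1..n})"
proof (rule sym, rule arg_min_on_eqI)
  let ?V = "{w (i k) | k. k \<in> {1..n}}"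
  have V: "?V = (\<lambda>k. w (i k)) ` {1..n}" by auto
  have fin: "finite ?V" unfolding V by simp
  have "Min ?V \<in> ?V" using fin assms(2) unfolding V by (intro Min_in) auto
  then obtain k where k: "k \<in> {1..n}" "Min ?V = w (i k)" by auto
  have m: "m_perm n w i = i k"
    unfolding m_perm_def k(2) using permutes_inverses(2)[OF assms(1)] by simp
  show "m_perm n w i \<in> i ` {1..n}" using k m by auto
  show "w (m_perm n w i) \<le> w y" if "y \<in> i ` {1..n}" for y
    unfolding m k(2)[symmetric] using fin that by (intro Min_le) auto
  show "inj_on w (i ` {1..n})" using permutes_inj[OF assms(1)] inj_on_subset by blast
qed simp

lemma inversions_subset_separated:
  assumes "n \<ge> 1" and w: "\<forall>k\<in>{1..n}. w k permutes {1..r}"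
  shows "inversions n r w \<subseteq> {S. S \<subseteq> {1..r} \<and> card S = card {1..n} \<and> separates w {1..n} S}"
proof
  fix S assume "S \<in> inversions n r w"
  then obtain i where i: "\<forall>k\<in>{1..n}. i k \<in> {1..r}" "S = i ` {1..n}"
      "inj_on (\<lambda>k. m_perm n (w k) i) {1..n}"
    by (auto simp: inversions_def is_inversion_def)
  have eq: "m_perm n (w k) i = arg_min_on (w k) S" if "k \<in> {1..n}" for k
    unfolding i(2) using w that assms(1) by (blast intro: m_perm_eq_arg_min_on)
  have inj: "inj_on (\<lambda>k. arg_min_on (w k) S) {1..n}"
  proof (rule inj_onI)
    fix k l assume kl: "k \<in> {1..n}" "l \<in> {1..n}"
      and "arg_min_on (w k) S = arg_min_on (w l) S"
    then have "m_perm n (w k) i = m_perm n (w l) i" by (simp only: eq)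
    then show "k = l" using i(3) kl by (auto dest: inj_onD)
  qed
  have fin: "finite S" "S \<noteq> {}" using i(2) assms(1) by auto
  \<comment> \<open>the \<open>n\<close> distinct minima lie in \<open>S\<close>, so the \<open>n\<close> indices are distinct\<close>
  have "card {1..n} \<le> card S"
    by (rule card_inj_on_le[OF inj _ fin(1)]) (use arg_min_on_in[OF fin] in auto)
  moreover have "card S \<le> card {1..n}" unfolding i(2) by (rule card_image_le) simp
  ultimately show "S \<in> {S. S \<subseteq> {1..r} \<and> card S = card {1..n} \<and> separates w {1..n} S}"
    using i inj by (auto simp: separates_def)
qed

theorem theorem6p2:
  fixes n :: nat
  assumes "n \<ge> 2"
  shows "\<exists>C::real. \<forall>r\<ge>1. \<forall>w :: nat \<Rightarrow> nat \<Rightarrow> nat.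
           (\<forall>k\<in>{1..n}. w k permutes {1..r}) \<longrightarrow>
           real (card (inversions n r w))
             \<le> 2 * real r ^ n / (real n * fact n) + C * real r ^ (n - 1)"
proof (intro exI[of _ 1] allI impI)
  fix r :: nat and w :: "nat \<Rightarrow> nat \<Rightarrow> nat"
  assume w: "\<forall>k\<in>{1..n}. w k permutes {1..r}"
  let ?N = "{S. S \<subseteq> {1..r} \<and> card S = card {1..n} \<and> separates w {1..n} S}"
  have "inj_on (w k) {1..r}" if "k \<in> {1..n}" for k
    using w that permutes_inj_on by blast
  then have "n * card ?N \<le> 2 * (Suc r choose n)"
    using card_separated_le[of "{1..n}" "{1..r}" w] assms by simp
  moreover have "card (inversions n r w) \<le> card ?N"
    using inversions_subset_separated[of n w r] w assms by (intro card_mono) auto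
  ultimately have "n * card (inversions n r w) \<le> 2 * (Suc r choose n)"
    using mult_le_mono2 order_trans by blast
  also have "Suc r choose n = (r choose n) + (r choose (n - 1))"
    using assms by (cases n) auto
  finally have "real (n * card (inversions n r w)) \<le> real (2 * ((r choose n) + (r choose (n - 1))))"
    by (rule of_nat_mono)
  then have main: "real n * real (card (inversions n r w))
      \<le> 2 * real (r choose n) + 2 * real (r choose (n - 1))"
    by simp
  have choose_le: "real (r choose k) \<le> real r ^ k / fact k" for k
  proof -
    have "real ((r choose k) * fact k) \<le> real (r ^ k)"
      by (rule of_nat_mono[OF binomial_fact_pow])
    then show ?thesis by (simp add: field_simps)
  qed
  have "real r ^ (n - 1) / fact (n - 1) \<le> real r ^ (n - 1) / 1"
    by (intro divide_left_mono) auto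
  then have low: "real (r choose (n - 1)) \<le> real r ^ (n - 1)"
    using choose_le[of "n - 1"] by linarith
  \<comment> \<open>the hypothesis \<open>n \<ge> 2\<close> absorbs the factor 2, so that \<open>C = 1\<close> suffices\<close>
  have "2 * real (r choose (n - 1)) \<le> real n * real r ^ (n - 1)"
    using low assms by (intro mult_mono) auto
  with main choose_le[of n]
  have "real n * real (card (inversions n r w))
      \<le> 2 * (real r ^ n / fact n) + real n * real r ^ (n - 1)" by linarith
  then show "real (card (inversions n r w))
      \<le> 2 * real r ^ n / (real n * fact n) + 1 * real r ^ (n - 1)"
    using assms by (simp add: field_simps)
qed

end
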